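(* Let $n\ge 1$ and let $Z\subset\mathbb{R}^n$ be a zonotope. Then $Z$ is vertex generated, i.e. $Z+V(Z)=2Z$.
   Context: A zonotope in $\mathbb{R}^n$ is the Minkowski sum of a finite number of line segments. A polytope is the convex hull of a finite non-empty set of points; $V(P)$ denotes the set of vertices of the polytope $P$; $A+B=\{a+b:a\in A,b\in B\}$ is the Minkowski sum. A polytope $P\subset\mathbb{R}^n$ is called vertex generated (written $P\in\mathrm{VG}(\mathbb{R}^n)$) if $P+V(P)=2P$. *)

theory Defs
  imports "HOL-Analysis.Analysis"
begin

text \<open>
  Addition of sets, and hence the finite sum of sets below, is the Minkowski operation of
  \<open>HOL-Library.Set_Algebras\<close>. Segments may degenerate to points, and the empty
  sum is the zonotope \<open>{0}\<close>.
\<close>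

definition zonotope :: "'a::real_vector set \<Rightarrow> bool" where
  "zonotope Z \<longleftrightarrow>
     (\<exists>(m::nat) (a::nat \<Rightarrow> 'a) (b::nat \<Rightarrow> 'a). Z = (\<Sum>i<m. closed_segment (a i) (b i)))"

definition vertices :: "'a::real_vector set \<Rightarrow> 'a set" where
  "vertices P = {x. x extreme_point_of P}"

text \<open>
  Nonemptiness is required explicitly because \<^const>\<open>polytope\<close> also holds of the empty set.
  The dilate \<open>2P\<close> is the image of \<open>P\<close> under scaling. It agrees with \<open>P + P\<close>
  only by convexity.
\<close>

definition vertex_generated :: "'a::real_vector set \<Rightarrow> bool" where
  "vertex_generated P \<longleftrightarrow>
     polytope P \<and> P \<noteq> {} \<and> P + vertices P = (\<lambda>x. 2 *\<^sub>R x) ` P"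

end

theory Submission
  imports Defs
begin

text \<open>
  If \<open>P\<close> is symmetric about \<open>c\<close> and \<open>x \<in> P\<close>, write \<open>x = (1 - t) c + t y\<close> with
  \<open>0 \<le> t \<le> 1\<close> and \<open>y\<close> in a proper face \<open>F\<close>. By induction on the dimension, there is a vertex
  \<open>v\<close> of \<open>F\<close> with \<open>2 y - v \<in> F\<close>, and \<open>2 x - v = (1 - t) (2 c - v) + t (2 y - v)\<close> lies
  in \<open>P\<close>. Hence a polytope with centrally symmetric faces is vertex generated, and the faces
  of a zonotope are zonotopes.
\<close>

section \<open>Faces of Minkowski sums and of segments\<close>

text \<open>The summands of \<open>F\<close> are its traces on \<open>A\<close> and
  \<open>B\<close>: the points that have a partner in the other set with sum in \<open>F\<close>.
  Partners may depend on the point, so the inclusion \<open>F1 + F2 \<subseteq> F\<close> requires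
  that partners can be exchanged.\<close>

lemma face_of_set_plus:
  fixes A B :: "'a::real_vector set"
  assumes F: "F face_of A + B" and A: "convex A" and B: "convex B"
  obtains F1 F2 where "F1 face_of A" "F2 face_of B" "F = F1 + F2"
proof
  define F1 where "F1 = {a\<in>A. \<exists>b\<in>B. a + b \<in> F}"
  define F2 where "F2 = {b\<in>B. \<exists>a\<in>A. a + b \<in> F}"
  have "convex F"
    using F by (simp add: face_of_imp_convex)
  \<comment> \<open>The pairs \<open>a + b\<close>, \<open>a' + b'\<close> and
    \<open>a + b'\<close>, \<open>a' + b\<close> have the same midpoint. It lies in \<open>F\<close>
    by convexity, and the face property then pulls the second pair into \<open>F\<close>.\<close>
  have exchange: "a + b' \<in> F" if "a \<in> A" "a' \<in> A" "b \<in> B" "b' \<in> B" "a + b \<in> F" "a' + b' \<in> F"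
    for a a' b b'
  proof (cases "a + b' = a' + b")
    \<comment> \<open>The open segment between the exchanged points is empty here, so the face
      property gives nothing; the common midpoint is \<open>a + b'\<close> itself.\<close>
    case True
    have "(1/2) *\<^sub>R (a + b) + (1/2) *\<^sub>R (a' + b') \<in> F"
      using \<open>convex F\<close> that by (intro convexD) auto
    also have "(1/2) *\<^sub>R (a + b) + (1/2) *\<^sub>R (a' + b') = (1/2) *\<^sub>R ((a + b') + (a' + b))"
      by (simp add: algebra_simps)
    also have "\<dots> = a + b'"
      unfolding True [symmetric] by (simp flip: scaleR_2)
    finally show ?thesis .
  next
    case False
    have "midpoint (a + b) (a' + b') \<in> F"
      using \<open>convex F\<close> that by (meson convex_contains_segment midpoint_in_closed_segment subsetD)
    moreover have "midpoint (a + b) (a' + b') = midpoint (a + b') (a' + b)"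
      by (simp add: midpoint_def algebra_simps)
    ultimately have "midpoint (a + b') (a' + b) \<in> F"
      by simp
    moreover have "midpoint (a + b') (a' + b) \<in> open_segment (a + b') (a' + b)"
      using False by simp
    ultimately show ?thesis
      using F that by (blast dest: face_ofD intro: set_plus_intro)
  qed
  have conv: "u *\<^sub>R a + v *\<^sub>R a' + (u *\<^sub>R b + v *\<^sub>R b') = u *\<^sub>R (a + b) + v *\<^sub>R (a' + b')"
    for u v and a a' b b' :: 'a
    by (simp add: algebra_simps)
  have seg: "x + c \<in> open_segment (a + c) (b + c)" "c + x \<in> open_segment (c + a) (c + b)"
    if "x \<in> open_segment a b" for x a b c :: 'a
    using that open_segment_translation_eq[of c x a b] by (simp_all add: add.commute)
  show "F1 face_of A"
    unfolding face_of_def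
  proof (intro conjI ballI impI)
    show "F1 \<subseteq> A"
      by (auto simp: F1_def)
    show "convex F1"
    proof (rule convexI)
      fix a a' and u v :: real
      assume *: "a \<in> F1" "a' \<in> F1" "0 \<le> u" "0 \<le> v" "u + v = 1"
      then obtain b b' where "b \<in> B" "b' \<in> B" "a + b \<in> F" "a' + b' \<in> F"
        by (auto simp: F1_def)
      \<comment> \<open>The same combination of the partners \<open>b\<close> and \<open>b'\<close>
        serves as partner.\<close>
      with * show "u *\<^sub>R a + v *\<^sub>R a' \<in> F1"
        unfolding F1_def
        using convexD[OF A] convexD[OF B] convexD[OF \<open>convex F\<close>, of "a + b" "a' + b'" u v]
        by (auto simp: F1_def intro!: bexI[of _ "u *\<^sub>R b + v *\<^sub>R b'"] simp: conv)
    qed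
  next
    fix a a' x
    assume "a \<in> A" "a' \<in> A" "x \<in> F1" "x \<in> open_segment a a'"
    \<comment> \<open>Translating the segment by a partner of \<open>x\<close> puts a point of
      \<open>F\<close> strictly between two points of \<open>A + B\<close>, so this partner also
      serves \<open>a\<close> and \<open>a'\<close>.\<close>
    then show "a \<in> F1" "a' \<in> F1"
      using seg(1) face_ofD[OF F] unfolding F1_def by (blast intro: set_plus_intro)+
  qed
  show "F2 face_of B"
    unfolding face_of_def
  proof (intro conjI ballI impI)
    show "F2 \<subseteq> B"
      by (auto simp: F2_def)
    show "convex F2"
    proof (rule convexI)
      fix b b' and u v :: real
      assume *: "b \<in> F2" "b' \<in> F2" "0 \<le> u" "0 \<le> v" "u + v = 1"
      then obtain a a' where "a \<in> A" "a' \<in> A" "a + b \<in> F" "a' + b' \<in> F"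
        by (auto simp: F2_def)
      with * show "u *\<^sub>R b + v *\<^sub>R b' \<in> F2"
        unfolding F2_def
        using convexD[OF A] convexD[OF B] convexD[OF \<open>convex F\<close>, of "a + b" "a' + b'" u v]
        by (auto simp: F2_def intro!: bexI[of _ "u *\<^sub>R a + v *\<^sub>R a'"] simp: conv)
    qed
  next
    fix b b' x
    assume "b \<in> B" "b' \<in> B" "x \<in> F2" "x \<in> open_segment b b'"
    then show "b \<in> F2" "b' \<in> F2"
      using seg(2) face_ofD[OF F] unfolding F2_def by (blast intro: set_plus_intro)+
  qed
  show "F = F1 + F2"
  proof
    show "F \<subseteq> F1 + F2"
    proof
      fix x assume "x \<in> F"
      moreover obtain a b where "a \<in> A" "b \<in> B" "x = a + b"
        using face_of_imp_subset[OF F] \<open>x \<in> F\<close> by (meson set_plus_elim subsetD)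
      ultimately show "x \<in> F1 + F2"
        by (auto simp: F1_def F2_def intro!: set_plus_intro)
    qed
    show "F1 + F2 \<subseteq> F"
      using exchange by (auto simp: F1_def F2_def elim!: set_plus_elim)
  qed
qed

text \<open>A face with a point other than the endpoints contains both of them by the face property,
  hence the whole segment. Otherwise it is a single endpoint or, by convexity, again
  everything.\<close>

lemma face_of_closed_segment:
  fixes a b :: "'a::real_vector"
  assumes F: "F face_of closed_segment a b" "F \<noteq> {}"
  obtains c d where "F = closed_segment c d"
proof (cases "F \<subseteq> {a, b}")
  case True
  have "convex F"
    using F(1) by (rule face_of_imp_convex)
  show ?thesis
  proof (cases "a \<in> F \<and> b \<in> F")
    case True
    then have "closed_segment a b \<subseteq> F"
      using \<open>convex F\<close> by (simp add: closed_segment_subset)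
    then show ?thesis
      using that face_of_imp_subset[OF F(1)] by blast
  next
    case False
    then have "F = {a} \<or> F = {b}"
      using True F(2) by blast
    then show ?thesis
      using that[of a a] that[of b b] by auto
  qed
next
  case False
  then obtain x where "x \<in> F" "x \<noteq> a" "x \<noteq> b"
    by blast
  then have "x \<in> open_segment a b"
    using face_of_imp_subset[OF F(1)] by (auto simp: open_segment_def)
  then have "a \<in> F" "b \<in> F"
    using face_ofD[OF F(1)] \<open>x \<in> F\<close> by (meson ends_in_segment)+
  then have "closed_segment a b \<subseteq> F"
    using F(1) by (simp add: closed_segment_subset face_of_imp_convex)
  then show ?thesis
    using that face_of_imp_subset[OF F(1)] by blast
qed

section \<open>Zonotopes, built up one segment at a time\<close>

lemma zonotope_induct [consumes 1, case_names zero plus]: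
  assumes "zonotope Z"
    and zero: "P {0}"
    and plus: "\<And>Y a b. zonotope Y \<Longrightarrow> P Y \<Longrightarrow> P (Y + closed_segment a b)"
  shows "P Z"
proof -
  obtain m :: nat and a b where Z: "Z = (\<Sum>i<m. closed_segment (a i) (b i))"
    using assms(1) unfolding zonotope_def by blast
  have "P (\<Sum>i<m. closed_segment (a i) (b i))"
  proof (induction m)
    case 0
    show ?case
      using zero by (simp add: set_zero)
  next
    case (Suc m)
    have "zonotope (\<Sum>i<m. closed_segment (a i) (b i))"
      unfolding zonotope_def by blast
    then show ?case
      using plus Suc by simp
  qed
  then show ?thesis
    by (simp add: Z)
qed

lemma zonotope_zero: "zonotope {0}"
  unfolding zonotope_def by (rule exI[of _ 0]) (simp add: set_zero)

lemma zonotope_plus_segment: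
  assumes "zonotope Z"
  shows "zonotope (Z + closed_segment c d)"
proof -
  obtain m :: nat and a b where Z: "Z = (\<Sum>i<m. closed_segment (a i) (b i))"
    using assms unfolding zonotope_def by blast
  \<comment> \<open>The new segment gets the index \<open>m\<close>, so the updates do not affect
    the sum over \<open>i < m\<close>.\<close>
  have "Z + closed_segment c d =
      (\<Sum>i<Suc m. closed_segment ((a(m := c)) i) ((b(m := d)) i))"
    unfolding Z by simp
  then show ?thesis
    unfolding zonotope_def by blast
qed

lemma zonotope_nonempty: "zonotope Z \<Longrightarrow> Z \<noteq> {}"
  by (induction rule: zonotope_induct) (auto simp: set_plus_def)

text \<open>Convex hulls commute with Minkowski sums, so \<open>A + B\<close> is the hull of the
  finite set \<open>S + T\<close>.\<close>

lemma polytope_set_plus: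
  fixes A B :: "'a::euclidean_space set"
  assumes "polytope A" "polytope B"
  shows "polytope (A + B)"
proof -
  obtain S T where "finite S" "finite T" "A = convex hull S" "B = convex hull T"
    using assms by (auto simp: polytope_def)
  then show ?thesis
    by (simp add: polytope_def) (metis convex_hull_set_plus finite_set_plus)
qed

lemma zonotope_polytope:
  fixes Z :: "'a::euclidean_space set"
  shows "zonotope Z \<Longrightarrow> polytope Z"
proof (induction rule: zonotope_induct)
  case zero
  show ?case
    by (rule polytope_sing)
next
  case (plus Y a b)
  have "polytope (closed_segment a b)"
    by (simp add: segment_convex_hull polytope_convex_hull)
  then show ?case
    using plus by (simp add: polytope_set_plus)
qed

lemma zonotope_convex: "zonotope Z \<Longrightarrow> convex Z"
  by (induction rule: zonotope_induct) (auto intro: convex_set_plus)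

text \<open>A face of \<open>Y + closed_segment a b\<close> splits into a face of \<open>Y\<close>,
  a zonotope by induction, and a face of the segment, again a segment.\<close>

lemma zonotope_face:
  assumes "zonotope Z" "F face_of Z" "F \<noteq> {}"
  shows "zonotope F"
  using assms
proof (induction arbitrary: F rule: zonotope_induct)
  case zero
  then have "F = {0}"
    using face_of_imp_subset by blast
  then show ?case
    by (simp add: zonotope_zero)
next
  case (plus Y a b)
  obtain F1 F2 where F: "F1 face_of Y" "F2 face_of closed_segment a b" "F = F1 + F2"
    using face_of_set_plus[OF plus.prems(1)] plus.hyps zonotope_convex by blast
  then have "F1 \<noteq> {}" "F2 \<noteq> {}"
    using plus.prems(2) by (auto simp: set_plus_def)
  moreover obtain c d where "F2 = closed_segment c d"
    using face_of_closed_segment F(2) \<open>F2 \<noteq> {}\<close> by blast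
  ultimately show ?case
    using plus.IH F by (simp add: zonotope_plus_segment)
qed

section \<open>Central symmetry\<close>

text \<open>Reflection in \<open>c\<close> is an involution, so mapping \<open>P\<close> into itself
  already means mapping it onto itself.\<close>

definition centrally_symmetric :: "'a::real_vector set \<Rightarrow> bool" where
  "centrally_symmetric P \<longleftrightarrow> (\<exists>c. \<forall>x\<in>P. 2 *\<^sub>R c - x \<in> P)"

text \<open>Centres add under Minkowski sums, and the centre of a segment is its midpoint.\<close>

lemma zonotope_centrally_symmetric: "zonotope Z \<Longrightarrow> centrally_symmetric Z"
proof (induction rule: zonotope_induct)
  case zero
  show ?case
    by (auto simp: centrally_symmetric_def)
next
  case (plus Y a b)
  obtain c where c: "\<And>x. x \<in> Y \<Longrightarrow> 2 *\<^sub>R c - x \<in> Y"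
    using plus.IH by (auto simp: centrally_symmetric_def)
  have seg: "a + b - x \<in> closed_segment a b" if x: "x \<in> closed_segment a b" for x
  proof -
    obtain u where u: "0 \<le> u" "u \<le> 1" "x = (1 - u) *\<^sub>R a + u *\<^sub>R b"
      using x by (auto simp: in_segment)
    then have "a + b - x = (1 - (1 - u)) *\<^sub>R a + (1 - u) *\<^sub>R b"
      by (simp add: algebra_simps)
    with u show ?thesis
      unfolding in_segment by (intro exI[of _ "1 - u"]) simp
  qed
  have "2 *\<^sub>R (c + midpoint a b) - x \<in> Y + closed_segment a b"
    if x: "x \<in> Y + closed_segment a b" for x
  proof -
    obtain y s where "y \<in> Y" "s \<in> closed_segment a b" "x = y + s"
      using x by (auto elim: set_plus_elim)
    moreover have "2 *\<^sub>R (c + midpoint a b) - (y + s) = (2 *\<^sub>R c - y) + (a + b - s)"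
      by (simp add: midpoint_def algebra_simps)
    ultimately show ?thesis
      using c seg by (metis set_plus_intro)
  qed
  then show ?case
    unfolding centrally_symmetric_def by blast
qed

text \<open>The point \<open>y\<close> is where the ray from \<open>c\<close> through
  \<open>x\<close> leaves \<open>P\<close>. If this happens at
  \<open>c + d *\<^sub>R (x - c)\<close>, then \<open>t = 1 / d\<close>.\<close>

lemma centrally_symmetric_through_rel_frontier:
  fixes P :: "'a::euclidean_space set"
  assumes "convex P" "bounded P"
    and c: "\<And>x. x \<in> P \<Longrightarrow> 2 *\<^sub>R c - x \<in> P"
    and "x \<in> P" "x \<noteq> c"
  obtains y t where "y \<in> rel_frontier P" "0 \<le> t" "t \<le> 1" "x = (1 - t) *\<^sub>R c + t *\<^sub>R y"
proof -
  have shrink: "z \<in> rel_interior P"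
    if "p \<in> rel_interior P" "q \<in> P" "z \<in> open_segment p q" for p q z
    using rel_interior_closure_convex_segment[OF \<open>convex P\<close>, of p q] closure_subset that by blast
  obtain q where q: "q \<in> rel_interior P"
    using \<open>convex P\<close> \<open>x \<in> P\<close> rel_interior_eq_empty by blast
  then have "q \<in> P"
    using rel_interior_subset by blast
  \<comment> \<open>The centre is halfway between the relative interior point \<open>q\<close> and
    its reflection, which lies in \<open>P\<close>.\<close>
  have c_int: "c \<in> rel_interior P"
  proof (cases "q = c")
    case True
    with q show ?thesis
      by simp
  next
    case False
    have "midpoint q (2 *\<^sub>R c - q) = c"
      by (simp add: midpoint_def)
    moreover have "q \<noteq> 2 *\<^sub>R c - q"
      using False calculation midpoint_idem by metis
    ultimately have "c \<in> open_segment q (2 *\<^sub>R c - q)"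
      by (metis midpoint_in_open_segment)
    then show ?thesis
      using shrink q c \<open>q \<in> P\<close> by blast
  qed
  have "c + (x - c) \<in> affine hull P"
    using \<open>x \<in> P\<close> by (simp add: hull_inc)
  then obtain d where d: "0 < d" "c + d *\<^sub>R (x - c) \<in> rel_frontier P"
    using ray_to_rel_frontier[OF \<open>bounded P\<close> c_int, of "x - c"] \<open>x \<noteq> c\<close> by auto
  \<comment> \<open>An exit point before \<open>x\<close> would lie strictly between
    \<open>c\<close> and \<open>x\<close>, hence in the relative interior.\<close>
  have "d \<ge> 1"
  proof (rule ccontr)
    assume "\<not> d \<ge> 1"
    moreover have "c + d *\<^sub>R (x - c) = (1 - d) *\<^sub>R c + d *\<^sub>R x"
      by (simp add: algebra_simps)
    ultimately have "c + d *\<^sub>R (x - c) \<in> open_segment c x"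
      using d(1) \<open>x \<noteq> c\<close> by (auto simp: in_segment intro!: exI[of _ d])
    then have "c + d *\<^sub>R (x - c) \<in> rel_interior P"
      using shrink c_int \<open>x \<in> P\<close> by blast
    with d(2) show False
      by (simp add: rel_frontier_def)
  qed
  show ?thesis
  proof
    show "c + d *\<^sub>R (x - c) \<in> rel_frontier P"
      by (fact d(2))
    show "0 \<le> 1 / d" "1 / d \<le> 1"
      using \<open>d \<ge> 1\<close> by auto
    show "x = (1 - 1 / d) *\<^sub>R c + (1 / d) *\<^sub>R (c + d *\<^sub>R (x - c))"
      using d(1) by (simp add: algebra_simps)
  qed
qed

section \<open>Reflecting vertices and vertex generation\<close>

lemma exists_reflecting_vertex:
  fixes P :: "'a::euclidean_space set"
  assumes "polytope P" "x \<in> P"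
    and "\<And>F. F face_of P \<Longrightarrow> F \<noteq> {} \<Longrightarrow> centrally_symmetric F"
  shows "\<exists>v. v extreme_point_of P \<and> 2 *\<^sub>R x - v \<in> P"
  using assms
proof (induction "nat (aff_dim P)" arbitrary: P x rule: less_induct)
  case less
  have "convex P" "compact P" "bounded P"
    using \<open>polytope P\<close> by (auto intro: polytope_imp_convex polytope_imp_compact polytope_imp_bounded)
  have "P \<noteq> {}"
    using \<open>x \<in> P\<close> by blast
  then obtain c where c: "\<And>x. x \<in> P \<Longrightarrow> 2 *\<^sub>R c - x \<in> P"
    using less.prems(3)[of P] \<open>convex P\<close> by (auto simp: centrally_symmetric_def face_of_refl)
  show ?case
  proof (cases "x = c")
    \<comment> \<open>At the centre every vertex works.\<close>
    case True
    obtain v where "v extreme_point_of P"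
      using extreme_point_exists_convex[OF \<open>compact P\<close> \<open>convex P\<close> \<open>P \<noteq> {}\<close>] .
    then show ?thesis
      using c True by (auto simp: extreme_point_of_def)
  next
    case False
    obtain y t where y: "y \<in> rel_frontier P" and t: "0 \<le> t" "t \<le> 1"
      and x: "x = (1 - t) *\<^sub>R c + t *\<^sub>R y"
      using centrally_symmetric_through_rel_frontier[OF \<open>convex P\<close> \<open>bounded P\<close> c \<open>x \<in> P\<close> False] .
    \<comment> \<open>The relative frontier of a polytope is the union of its proper faces.\<close>
    obtain F where F: "F face_of P" "F \<noteq> P" "y \<in> F"
      using y rel_frontier_of_polyhedron_alt[OF polytope_imp_polyhedron[OF \<open>polytope P\<close>]] by auto
    have "aff_dim F < aff_dim P"
      using F \<open>convex P\<close> by (simp add: face_of_aff_dim_lt)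
    \<comment> \<open>Together with the strict inequality this makes \<open>aff_dim P\<close>
      positive, so the decrease survives \<open>nat\<close>.\<close>
    moreover have "0 \<le> aff_dim F"
      using F(3) using aff_dim_subset[of "{y}" F] by simp
    ultimately have "nat (aff_dim F) < nat (aff_dim P)"
      by linarith
    moreover have "centrally_symmetric G" if "G face_of F" "G \<noteq> {}" for G
      using that less.prems(3) face_of_trans F(1) by blast
    moreover have "polytope F"
      using F(1) \<open>polytope P\<close> by (rule face_of_polytope_polytope[rotated])
    ultimately obtain v where v: "v extreme_point_of F" "2 *\<^sub>R y - v \<in> F"
      using less.hyps F(3) by blast
    have "v extreme_point_of P"
      using v(1) F(1) extreme_point_of_face by blast
    moreover have "(1 - t) *\<^sub>R (2 *\<^sub>R c - v) + t *\<^sub>R (2 *\<^sub>R y - v) \<in> P"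
      using c[of v] calculation v(2) face_of_imp_subset[OF F(1)] t
      by (intro convexD[OF \<open>convex P\<close>]) (auto simp: extreme_point_of_def)
    moreover have "(1 - t) *\<^sub>R (2 *\<^sub>R c - v) + t *\<^sub>R (2 *\<^sub>R y - v) = 2 *\<^sub>R x - v"
      unfolding x by (simp add: algebra_simps)
    ultimately show ?thesis
      by auto
  qed
qed

lemma vertex_generated_if_faces_centrally_symmetric:
  fixes P :: "'a::euclidean_space set"
  assumes "polytope P" "P \<noteq> {}"
    and faces: "\<And>F. F face_of P \<Longrightarrow> F \<noteq> {} \<Longrightarrow> centrally_symmetric F"
  shows "vertex_generated P"
  unfolding vertex_generated_def
proof (intro conjI subset_antisym subsetI)
  fix z assume "z \<in> P + vertices P"
  then obtain x v where "x \<in> P" "v \<in> P" "z = x + v"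
    by (auto simp: vertices_def extreme_point_of_def elim!: set_plus_elim)
  \<comment> \<open>This inclusion uses only convexity; the reverse one writes
    \<open>2 *\<^sub>R x\<close> as \<open>(2 *\<^sub>R x - v) + v\<close> with a reflecting vertex
    \<open>v\<close>.\<close>
  moreover have "midpoint x v \<in> P"
    using polytope_imp_convex[OF \<open>polytope P\<close>] calculation
    by (meson convex_contains_segment midpoint_in_closed_segment subsetD)
  ultimately show "z \<in> (\<lambda>x. 2 *\<^sub>R x) ` P"
    by (intro image_eqI[of _ _ "midpoint x v"]) (auto simp: midpoint_def)
next
  fix z assume "z \<in> (\<lambda>x. 2 *\<^sub>R x) ` P"
  then obtain x where "x \<in> P" "z = 2 *\<^sub>R x"
    by blast
  moreover obtain v where "v extreme_point_of P" "2 *\<^sub>R x - v \<in> P"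
    using exists_reflecting_vertex[OF \<open>polytope P\<close> \<open>x \<in> P\<close> faces] by blast
  ultimately show "z \<in> P + vertices P"
    using set_plus_intro[of "2 *\<^sub>R x - v" P v "vertices P"] by (simp add: vertices_def)
qed (fact assms)+

theorem corollary1p3:
  fixes Z :: "(real ^ 'n) set"
  assumes "zonotope Z"
  shows "vertex_generated Z"
  using assms
  by (intro vertex_generated_if_faces_centrally_symmetric)
    (auto intro: zonotope_polytope zonotope_nonempty zonotope_centrally_symmetric zonotope_face
      dest: zonotope_nonempty)

end
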